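(* Let $d$ be a positive integer and $n \geq 12d^2+4d$. Consider the Zeckendorf game on $n$ with $3d$ players divided into two alliances: a small alliance consisting of $d$ cyclically consecutive players and a big alliance consisting of the remaining $2d$ (cyclically consecutive) players. Then the big alliance always has a winning strategy.
   Context: Let $F_1=1$, $F_2=2$, $F_{i+1}=F_i+F_{i-1}$. The Zeckendorf game on $n$ starts with the multiset of $n$ copies of $1$. A move is one of: if the list contains $F_{i-1}$ and $F_i$, replace them by $F_{i+1}$; if the list contains two copies of $F_i$: for $i=1$ replace them by $F_2$; for $i=2$ replace them by $F_1,F_3$; for $i\geq 3$ replace them by $F_{i-2},F_{i+1}$. The game ends when the list is the Zeckendorf decomposition of $n$ (distinct, pairwise non-consecutive Fibonacci numbers); every game terminates. With $p$ players, players $1,\dots,p$ move in cyclic order $1,2,\dots,p,1,2,\dots$ starting with player 1; players $i$ and $i+1 \pmod p$ are consecutive. An alliance wins if the final move (creating the Zeckendorf decomposition) is made by one of its members; it has a winning strategy if its members can choose their moves so that the final move is made by a member no matter what moves the other players make. *)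

theory Defs
  imports "HOL-Number_Theory.Number_Theory" "HOL-Library.Multiset"
begin

text \<open>The Fibonacci numbers with \<open>F\<^sub>1 = 1\<close>, \<open>F\<^sub>2 = 2\<close>: the library sequence shifted by one.
  Only indices \<open>i \<ge> 1\<close> are used.\<close>

definition zfib :: "nat \<Rightarrow> nat" where
  "zfib i = fib (Suc i)"

lemma zfib_rec: "zfib 1 = 1" "zfib 2 = 2" "i \<ge> 2 \<Longrightarrow> zfib (i + 1) = zfib i + zfib (i - 1)"
  by (auto simp: zfib_def numeral_2_eq_2 gr0_conv_Suc dest!: le_Suc_ex)

inductive zmove :: "nat multiset \<Rightarrow> nat multiset \<Rightarrow> bool" where
  combine: "i \<ge> 2 \<Longrightarrow> zmove (M + {#zfib (i - 1), zfib i#}) (M + {#zfib (i + 1)#})"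
| merge_ones: "zmove (M + {#zfib 1, zfib 1#}) (M + {#zfib 2#})"
| split_twos: "zmove (M + {#zfib 2, zfib 2#}) (M + {#zfib 1, zfib 3#})"
| split: "i \<ge> 3 \<Longrightarrow> zmove (M + {#zfib i, zfib i#}) (M + {#zfib (i - 2), zfib (i + 1)#})"

definition zeckendorf_decomposition :: "nat \<Rightarrow> nat multiset \<Rightarrow> bool" where
  "zeckendorf_decomposition n M \<longleftrightarrow> \<Sum>\<^sub># M = n \<and>
     (\<exists>I. finite I \<and> (\<forall>i\<in>I. i \<ge> 1 \<and> Suc i \<notin> I) \<and> M = image_mset zfib (mset_set I))"

text \<open>A play is the nonempty list of positions visited so far; it is complete
  once its last position is the Zeckendorf decomposition of \<open>n\<close>.\<close>

definition play :: "nat \<Rightarrow> nat multiset list \<Rightarrow> bool" where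
  "play n h \<longleftrightarrow> h \<noteq> [] \<and> hd h = replicate_mset n 1 \<and>
     (\<forall>k. Suc k < length h \<longrightarrow> \<not> zeckendorf_decomposition n (h ! k) \<and> zmove (h ! k) (h ! Suc k))"

definition complete_play :: "nat \<Rightarrow> nat multiset list \<Rightarrow> bool" where
  "complete_play n h \<longleftrightarrow> play n h \<and> zeckendorf_decomposition n (last h)"

text \<open>With \<open>p\<close> players numbered \<open>1, \<dots>, p\<close>, the move from position \<open>h ! k\<close> to \<open>h ! Suc k\<close>
  is made by \<open>mover p k\<close>.\<close>

definition next_player :: "nat \<Rightarrow> nat \<Rightarrow> nat" where
  "next_player p i = i mod p + 1"

definition mover :: "nat \<Rightarrow> nat \<Rightarrow> nat" where
  "mover p k = (next_player p ^^ k) 1"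

definition consecutive_players :: "nat \<Rightarrow> nat set \<Rightarrow> bool" where
  "consecutive_players p A \<longleftrightarrow>
     (\<exists>a\<in>{1..p}. \<exists>k\<le>p. A = {(next_player p ^^ j) a |j. j < k})"

text \<open>A joint strategy maps the history so far to the next position; it is only consulted
  when a member of the alliance \<open>A\<close> is to move.\<close>

type_synonym strategy = "nat multiset list \<Rightarrow> nat multiset"

definition follows :: "nat \<Rightarrow> nat set \<Rightarrow> strategy \<Rightarrow> nat multiset list \<Rightarrow> bool" where
  "follows p A \<sigma> h \<longleftrightarrow>
     (\<forall>k. Suc k < length h \<longrightarrow> mover p k \<in> A \<longrightarrow> h ! Suc k = \<sigma> (take (Suc k) h))"

text \<open>The first condition says that the strategy prescribes legal moves, the second that no play
  following it goes on forever, the third that the last move of every complete play following it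
  is made by a member of \<open>A\<close>. A play cannot get stuck before it is complete,
  see \<open>play_not_stuck\<close> below.\<close>

definition winning_strategy :: "nat \<Rightarrow> nat \<Rightarrow> nat set \<Rightarrow> strategy \<Rightarrow> bool" where
  "winning_strategy n p A \<sigma> \<longleftrightarrow>
     (\<forall>h. play n h \<and> follows p A \<sigma> h \<and> \<not> zeckendorf_decomposition n (last h) \<and>
          mover p (length h - 1) \<in> A \<longrightarrow> zmove (last h) (\<sigma> h)) \<and>
     \<not> (\<exists>s :: nat \<Rightarrow> nat multiset.
          \<forall>m. play n (map s [0..<Suc m]) \<and> follows p A \<sigma> (map s [0..<Suc m])) \<and>
     (\<forall>h. complete_play n h \<and> follows p A \<sigma> h \<longrightarrow>
          length h \<ge> 2 \<and> mover p (length h - 2) \<in> A)"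

definition has_winning_strategy :: "nat \<Rightarrow> nat \<Rightarrow> nat set \<Rightarrow> bool" where
  "has_winning_strategy n p A \<longleftrightarrow> (\<exists>\<sigma>. winning_strategy n p A \<sigma>)"

lemma zmove_sum: "zmove M N \<Longrightarrow> \<Sum>\<^sub># N = \<Sum>\<^sub># M"
proof (induction rule: zmove.induct)
  case (combine i M)
  then show ?case using zfib_rec(3)[of i] by simp
next
  case (split i M)
  then obtain j where "i = j + 3" using le_Suc_ex by (metis add.commute)
  then show ?case by (simp add: zfib_def numeral_eq_Suc)
qed (auto simp: zfib_def numeral_eq_Suc)

lemma zmove_set: "zmove M N \<Longrightarrow> set_mset M \<subseteq> zfib ` {1..} \<Longrightarrow> set_mset N \<subseteq> zfib ` {1..}"
  by (induction rule: zmove.induct) auto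

lemma zfib_less: "i \<ge> 1 \<Longrightarrow> zfib i < zfib (Suc i)"
  by (cases i) (auto simp: zfib_def fib_neq_0_nat)

lemma zfib_inj: "inj_on zfib {1..}"
proof -
  have "zfib i < zfib j" if "1 \<le> i" "i < j" for i j
    using that(2,1)
    by (induction rule: strict_inc_induct) (use zfib_less in \<open>auto intro: less_trans\<close>)
  then show ?thesis
    by (intro linorder_inj_onI) (auto, metis less_irrefl)
qed

lemma zmove_exists:
  assumes "set_mset M \<subseteq> zfib ` {1..}" "\<not> zeckendorf_decomposition (\<Sum>\<^sub># M) M"
  shows "\<exists>N. zmove M N"
proof (rule ccontr)
  assume stuck: "\<not> (\<exists>N. zmove M N)"
  have single: "count M (zfib i) \<le> 1" if "i \<ge> 1" for i
  proof (rule ccontr)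
    assume "\<not> count M (zfib i) \<le> 1"
    then have "{#zfib i, zfib i#} \<subseteq># M"
      by (auto simp: subseteq_mset_def)
    then obtain K where "M = K + {#zfib i, zfib i#}"
      by (metis subset_mset.le_iff_add add.commute)
    moreover have "i = 1 \<or> i = 2 \<or> i \<ge> 3" using that by auto
    ultimately show False
      using stuck zmove.merge_ones[of K] zmove.split_twos[of K] zmove.split[of i K] by auto
  qed
  define I where "I = {i. i \<ge> 1 \<and> zfib i \<in># M}"
  have inj: "inj_on zfib I" using zfib_inj by (rule inj_on_subset) (auto simp: I_def)
  have img: "zfib ` I = set_mset M" using assms(1) by (auto simp: I_def)
  then have fin: "finite I" using inj by (metis finite_set_mset finite_imageD)
  have "Suc i \<notin> I" if "i \<in> I" for i
  proof
    assume "Suc i \<in> I"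
    with that have "zfib i \<in># M" "zfib (Suc i) \<in># M" "i \<ge> 1" by (auto simp: I_def)
    moreover have "zfib i \<noteq> zfib (Suc i)" using zfib_less[of i] \<open>i \<ge> 1\<close> by simp
    ultimately obtain K where "M = K + {#zfib (Suc i - 1), zfib (Suc i)#}"
      by (metis (no_types, lifting) add_mset_add_single diff_Suc_1 insert_DiffM insert_noteq_member
          multi_member_split union_mset_add_mset_right add.right_neutral)
    then show False using stuck zmove.combine[of "Suc i" K] \<open>i \<ge> 1\<close> by auto
  qed
  moreover have "M = image_mset zfib (mset_set I)"
  proof -
    have "M = mset_set (set_mset M)"
    proof (rule multiset_eqI)
      fix x
      show "count M x = count (mset_set (set_mset M)) x"
      proof (cases "x \<in># M")
        case True
        then obtain i where "x = zfib i" "i \<ge> 1" using assms(1) by auto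
        with single[of i] True show ?thesis
          by (metis One_nat_def count_mset_set(1) count_greater_zero_iff finite_set_mset le_antisym
              Suc_leI)
      qed (simp add: not_in_iff)
    qed
    then show ?thesis using image_mset_mset_set[OF inj] img by simp
  qed
  ultimately show False
    using assms(2) fin unfolding zeckendorf_decomposition_def I_def by blast
qed

lemma play_not_stuck:
  assumes "play n h" "\<not> zeckendorf_decomposition n (last h)"
  shows "\<exists>N. zmove (last h) N"
proof -
  have "\<Sum>\<^sub># (h ! k) = n \<and> set_mset (h ! k) \<subseteq> zfib ` {1..}" if "k < length h" for k
    using that
  proof (induction k)
    case 0
    have "zfib 1 = 1" by (rule zfib_rec)
    then have "1 \<in> zfib ` {1..}" by (metis atLeast_iff imageI order_refl)
    moreover have "h ! 0 = replicate_mset n 1" using assms(1) by (auto simp: play_def hd_conv_nth)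
    ultimately show ?case by (simp only: sum_mset_replicate_mset set_mset_replicate_mset_subset) simp
  next
    case (Suc k)
    then show ?case using assms(1) zmove_sum zmove_set unfolding play_def
      by (metis Suc_lessD)
  qed
  from this[of "length h - 1"] have "\<Sum>\<^sub># (last h) = n \<and> set_mset (last h) \<subseteq> zfib ` {1..}"
    using assms(1) by (auto simp: play_def last_conv_nth)
  then show ?thesis using zmove_exists assms(2) by blast
qed

end

theory Submission
  imports Defs
begin

text \<open>Write \<open>m\<close>, \<open>c\<close>, \<open>s\<close> for the moves \<open>1+1 \<rightarrow> 2\<close>, \<open>1+2 \<rightarrow> 3\<close>, \<open>2+2 \<rightarrow> 1+3\<close>; performing \<open>m\<close> and then
  \<open>s\<close> has the same effect as the single move \<open>c\<close>. Suppose that the big alliance cannot force a win. By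
  strategy stealing it then cannot reach one position at two times that are \<open>d\<close> moves apart:
  otherwise the small alliance, shifted by \<open>d\<close> players, would be a part of the big one that could
  force a win as well. Consider a position with many ones at the start of a block of \<open>2d\<close> moves of
  the big alliance. If it contains at least \<open>d\<close> twos, then \<open>c\<^sup>d\<close> and \<open>m\<^sup>d s\<^sup>d\<close> lead to the same
  position after \<open>d\<close> and after \<open>2d\<close> moves, a contradiction. Otherwise the big alliance plays
  \<open>m\<^sup>2\<^sup>d\<close>. If the small alliance replies \<open>s\<^sup>d\<close>, the position after \<open>3d\<close> moves could have been
  reached in \<open>2d\<close> moves by \<open>m\<^sup>d c\<^sup>d\<close>, a contradiction. Any other reply removes at most \<open>2d - 1\<close>
  twos, so the number of twos grows in every round and reaches \<open>d\<close> after at most \<open>d\<close> rounds.\<close>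

section \<open>Termination\<close>

lemma zfib_pos: "zfib i > 0"
  by (simp add: zfib_def fib_neq_0_nat)

definition sum_squares :: "nat multiset \<Rightarrow> nat" where
  "sum_squares M = (\<Sum>x\<in>#M. x\<^sup>2)"

lemma sum_squares_le: "sum_squares M \<le> (\<Sum>\<^sub># M)\<^sup>2"
  by (induction M) (auto simp: sum_squares_def power2_sum)

text \<open>Replacing a and b by a + b adds 2ab; a split with a = F_{i-2}, b = F_{i-1} adds 2b^2,
  because F_i = a + b and F_{i+1} = a + 2b. As the sum is invariant, the potential is bounded, which
  gives termination.\<close>

lemma zmove_sum_squares: "zmove M N \<Longrightarrow> sum_squares M < sum_squares N"
proof (induction rule: zmove.induct)
  case (combine i M)
  then show ?case
    using zfib_rec(3)[of i] zfib_pos[of i] zfib_pos[of "i - 1"]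
    by (simp add: sum_squares_def power2_sum)
next
  case (split i M)
  then obtain j where i: "i = j + 3" by (metis add.commute le_Suc_ex)
  define a where "a = zfib (j + 1)"
  define b where "b = zfib (j + 2)"
  have "zfib i = a + b" "zfib (i - 2) = a" "zfib (i + 1) = a + 2 * b"
    by (simp_all add: i a_def b_def zfib_def numeral_eq_Suc)
  moreover have "b > 0" by (simp add: b_def zfib_pos)
  moreover have "2 * (a + b)\<^sup>2 + 2 * b\<^sup>2 = a\<^sup>2 + (a + 2 * b)\<^sup>2"
    by (simp add: power2_eq_square algebra_simps)
  ultimately have "2 * (zfib i)\<^sup>2 < (zfib (i - 2))\<^sup>2 + (zfib (i + 1))\<^sup>2"
    by (metis less_add_same_cancel1 nat_0_less_mult_iff pos2 zero_less_power)
  then show ?case by (simp add: sum_squares_def)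
qed (auto simp: sum_squares_def zfib_def numeral_eq_Suc)

lemma wf_zmove: "wf {(N, M). zmove M N}"
proof (rule wf_subset)
  show "{(N, M). zmove M N} \<subseteq> measure (\<lambda>M. (\<Sum>\<^sub># M)\<^sup>2 - sum_squares M)"
  proof clarsimp
    fix M N assume "zmove M N"
    then show "(\<Sum>\<^sub># N)\<^sup>2 - sum_squares N < (\<Sum>\<^sub># M)\<^sup>2 - sum_squares M"
      using zmove_sum[of M N] zmove_sum_squares[of M N] sum_squares_le[of N]
      by (simp add: diff_less_mono2)
  qed
qed simp

text \<open>Each move consumes two equal or two neighbouring terms. So a legal move certifies that
  the game is not over.\<close>

lemma zmove_not_zeckendorf:
  assumes "zmove M N"
  shows "\<not> zeckendorf_decomposition n M"
proof
  assume "zeckendorf_decomposition n M"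
  then obtain I where I: "finite I" "\<And>i. i \<in> I \<Longrightarrow> i \<ge> 1 \<and> Suc i \<notin> I"
    and M: "M = image_mset zfib (mset_set I)"
    unfolding zeckendorf_decomposition_def by blast
  have inj: "inj_on zfib I" using zfib_inj by (rule inj_on_subset) (use I in auto)
  have M': "M = mset_set (zfib ` I)" by (simp add: M image_mset_mset_set[OF inj])
  have no_double: "M \<noteq> K + {#x, x#}" for K x
  proof
    assume "M = K + {#x, x#}"
    then have "count M x \<ge> 2" by simp
    then show False by (simp add: M' count_mset_set' split: if_splits)
  qed
  have mem: "i \<in> I" if "zfib i \<in># M" "i \<ge> 1" for i
  proof -
    from that obtain k where "k \<in> I" "zfib i = zfib k" using I(1) by (auto simp: M)
    with that I(2)[of k] show ?thesis using inj_onD[OF zfib_inj, of i k] by auto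
  qed
  from assms show False
  proof cases
    case (combine i K)
    then have "i - 1 \<in> I" "i \<in> I" by (auto intro!: mem)
    with I(2)[of "i - 1"] combine show False by auto
  qed (use no_double in blast)+
qed

section \<open>Forced wins and strategy stealing\<close>

text \<open>\<open>own k\<close> says that the move leading to the position at time \<open>k\<close> is made by the alliance.\<close>

inductive forces :: "nat \<Rightarrow> (nat \<Rightarrow> bool) \<Rightarrow> nat \<Rightarrow> nat multiset \<Rightarrow> bool" for n own where
  final: "zeckendorf_decomposition n M \<Longrightarrow> own t \<Longrightarrow> forces n own t M"
| own_move: "\<not> zeckendorf_decomposition n M \<Longrightarrow> own (Suc t) \<Longrightarrow> zmove M N \<Longrightarrow>
    forces n own (Suc t) N \<Longrightarrow> forces n own t M"
| other_move: "\<not> zeckendorf_decomposition n M \<Longrightarrow> \<not> own (Suc t) \<Longrightarrow>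
    (\<And>N. zmove M N \<Longrightarrow> forces n own (Suc t) N) \<Longrightarrow> forces n own t M"

definition position :: "nat \<Rightarrow> nat multiset \<Rightarrow> bool" where
  "position n M \<longleftrightarrow> \<Sum>\<^sub># M = n \<and> set_mset M \<subseteq> zfib ` {1..}"

lemma position_zmove: "position n M \<Longrightarrow> zmove M N \<Longrightarrow> position n N"
  using zmove_sum zmove_set by (simp add: position_def)

lemma position_start: "position n (replicate_mset n 1)"
proof -
  have "1 \<in> zfib ` {1..}" by (metis atLeast_iff imageI order_refl zfib_rec(1))
  then show ?thesis by (auto simp: position_def)
qed

text \<open>Two clocks run \<open>d\<close> apart. If both give the next move to the alliance, any
  move serves on one of them. If only one does, either some move wins on that clock or every move
  wins on the other.\<close>

lemma strategy_stealing:
  assumes "position n M" and shift: "\<And>k. own k \<or> own (k + d)"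
  shows "forces n own t M \<or> forces n own (t + d) M"
  using assms(1)
proof (induction M arbitrary: t rule: wf_induct_rule[OF wf_zmove])
  case (1 M)
  then have IH: "forces n own (Suc t) N \<or> forces n own (Suc (t + d)) N" if "zmove M N" for N
    using that position_zmove[OF 1(2) that] by fastforce
  show ?case
  proof (cases "zeckendorf_decomposition n M")
    case True
    then show ?thesis using shift[of t] by (auto intro: final)
  next
    case False
    then obtain N where "zmove M N" using 1(2) zmove_exists by (auto simp: position_def)
    moreover have "own (Suc t) \<or> own (Suc (t + d))" using shift[of "Suc t"] by simp
    ultimately show ?thesis
      using False IH by (metis own_move other_move)
  qed
qed

lemma forces_imp_winning_strategy:
  assumes B: "\<And>k. own (Suc k) \<longleftrightarrow> mover p k \<in> B"
    and start: "forces n own 0 (replicate_mset n 1)" "n \<ge> 2"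
  shows "has_winning_strategy n p B"
proof -
  \<comment> \<open>A history of length \<open>k + 1\<close> ends at time \<open>k\<close>, so
    \<open>length h\<close> is the time of the position chosen.\<close>
  define \<sigma> where "\<sigma> h = (SOME N. zmove (last h) N \<and> forces n own (length h) N)" for h
  have \<sigma>: "zmove (last h) (\<sigma> h) \<and> forces n own (length h) (\<sigma> h)"
    if "forces n own k (last h)" "length h = Suc k" "own (Suc k)"
      "\<not> zeckendorf_decomposition n (last h)" for h k
  proof -
    have "\<exists>N. zmove (last h) N \<and> forces n own (length h) N"
      using that(1) by cases (use that in auto)
    then show ?thesis unfolding \<sigma>_def by (rule someI_ex)
  qed
  have inv: "forces n own k (h ! k)" if "play n h" "follows p B \<sigma> h" "k < length h" for h k
    using that(3)
  proof (induction k)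
    case 0
    then show ?case using that(1) start by (simp add: play_def hd_conv_nth)
  next
    case (Suc k)
    then have IH: "forces n own k (h ! k)" by simp
    have step: "\<not> zeckendorf_decomposition n (h ! k)" "zmove (h ! k) (h ! Suc k)"
      using that(1) Suc.prems by (auto simp: play_def)
    show ?case
    proof (cases "own (Suc k)")
      case True
      have last: "last (take (Suc k) h) = h ! k" "length (take (Suc k) h) = Suc k"
        using Suc.prems by (simp_all add: take_Suc_conv_app_nth)
      have "h ! Suc k = \<sigma> (take (Suc k) h)"
        using that(2) True B Suc.prems by (simp add: follows_def)
      then show ?thesis using \<sigma>[of k "take (Suc k) h"] True IH step last by simp
    next
      case False
      from IH show ?thesis by cases (use False step in auto)
    qed
  qed
  have inv_last: "forces n own (length h - 1) (last h)" if "play n h" "follows p B \<sigma> h" for h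
    using inv[OF that, of "length h - 1"] that(1) by (simp add: play_def last_conv_nth)
  have "zmove (last h) (\<sigma> h)"
    if "play n h" "follows p B \<sigma> h" "\<not> zeckendorf_decomposition n (last h)"
      "mover p (length h - 1) \<in> B" for h
  proof -
    have len: "length h = Suc (length h - 1)" using that(1) by (cases h) (auto simp: play_def)
    show ?thesis using \<sigma>[OF inv_last[OF that(1,2)] len _ that(3)] that(4) B by blast
  qed
  moreover have "\<not> (\<forall>m. play n (map s [0..<Suc m]) \<and> follows p B \<sigma> (map s [0..<Suc m]))" for s
  proof
    assume *: "\<forall>m. play n (map s [0..<Suc m]) \<and> follows p B \<sigma> (map s [0..<Suc m])"
    have "zmove (s k) (s (Suc k))" for k
    proof -
      have "play n (map s [0..<Suc (Suc k)])" using * by blast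
      then have "zmove (map s [0..<Suc (Suc k)] ! k) (map s [0..<Suc (Suc k)] ! Suc k)"
        unfolding play_def by (metis diff_zero length_map length_upt lessI)
      then show ?thesis by (simp add: nth_append del: upt_Suc)
    qed
    then show False using wf_zmove by (auto simp: wf_iff_no_infinite_down_chain)
  qed
  moreover have "length h \<ge> 2 \<and> mover p (length h - 2) \<in> B"
    if "complete_play n h" "follows p B \<sigma> h" for h
  proof -
    have h: "play n h" "zeckendorf_decomposition n (last h)" "h \<noteq> []" "hd h = replicate_mset n 1"
      using that(1) by (auto simp: complete_play_def play_def)
    \<comment> \<open>Two ones allow a first move, so a complete play has at least one move.\<close>
    obtain k where "n = Suc (Suc k)" using start(2) by (metis add_2_eq_Suc le_Suc_ex)
    then have "zmove (replicate_mset n 1) (replicate_mset k 1 + {#zfib 2#})"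
      using zmove.merge_ones[of "replicate_mset k 1"] zfib_rec(1) by simp
    then have "\<not> zeckendorf_decomposition n (hd h)" using zmove_not_zeckendorf h(4) by metis
    then have len: "length h \<ge> 2" using h(2,3)
      by (metis One_nat_def Suc_1 Suc_leI hd_conv_nth last_conv_nth length_greater_0_conv
          diff_is_0_eq not_less_eq_eq)
    \<comment> \<open>At a final position only the rule \<open>final\<close> applies.\<close>
    from inv_last[OF h(1) that(2)] have "own (length h - 1)"
      by cases (use h(2) in auto)
    moreover have "length h - 1 = Suc (length h - 2)" using len by simp
    ultimately show ?thesis using len B by metis
  qed
  ultimately show ?thesis unfolding has_winning_strategy_def winning_strategy_def by blast
qed

section \<open>Blocks of moves\<close>

lemma zmove_merge: "zmove (Z + {#1, 1#}) (Z + {#2#})"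
  using zmove.merge_ones[of Z] by (simp add: zfib_rec(1,2)[unfolded One_nat_def])

lemma zfib_3: "zfib 3 = 3"
  using zfib_rec(3)[of 2] by (simp add: zfib_rec(1,2)[unfolded One_nat_def])

lemma zmove_split_twos: "zmove (Z + {#2, 2#}) (Z + {#1, 3#})"
  using zmove.split_twos[of Z] by (simp add: zfib_rec(1,2)[unfolded One_nat_def] zfib_3)

lemma zmove_combine: "zmove (Z + {#1, 2#}) (Z + {#3#})"
  using zmove.combine[of 2 Z] by (simp add: zfib_rec(1,2)[unfolded One_nat_def] zfib_3)

text \<open>Singles out the replies of type \<open>s\<close>: \<open>combine\<close> takes two
  distinct numbers, and \<open>split\<close> takes no twos as its index is at least 3.\<close>

lemma zmove_cases_twos:
  assumes "zmove M N"
  obtains (split_twos) K where "M = K + {#2, 2#}" "N = K + {#1, 3#}"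
  | (other) "count M 2 \<le> count N 2 + 1"
  using assms
proof cases
  case (combine i K)
  then have "1 \<le> i - 1" "Suc (i - 1) = i" by auto
  then have "zfib (i - 1) \<noteq> zfib i" using zfib_less[of "i - 1"] by simp
  then show ?thesis using combine by (intro other) auto
next
  case (merge_ones K)
  then show ?thesis using zfib_rec(1) by (intro other) simp
next
  case (split_twos K)
  then show ?thesis using zfib_rec(1,2) zfib_3 that(1) by simp
next
  case (split i K)
  then have "zfib i \<noteq> 2" using inj_onD[OF zfib_inj, of i 2] zfib_rec(2) by auto
  then show ?thesis using split by (intro other) simp
qed

lemma zmove_count_one: "zmove M N \<Longrightarrow> count M 1 \<le> count N 1 + 2"
  by (induction rule: zmove.induct) auto

lemma zmove_count_two: "zmove M N \<Longrightarrow> count M 2 \<le> count N 2 + 2"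
  by (erule zmove_cases_twos) auto

lemma mset_split_replicate:
  assumes "k \<le> count M (x :: 'a)"
  obtains Z where "M = Z + replicate_mset k x"
  using assms by (metis add.commute count_le_replicate_mset_subset_eq subset_mset.le_iff_add)

section \<open>Positions from which no win can be forced\<close>

context
  fixes n d :: nat and own :: "nat \<Rightarrow> bool"
  assumes shift: "own k \<or> own (k + d)"
begin

definition bad :: "nat \<Rightarrow> nat multiset \<Rightarrow> bool" where
  "bad t M \<longleftrightarrow> position n M \<and> \<not> forces n own t M"

lemma bad_shift: "bad t M \<Longrightarrow> \<not> bad (t + d) M"
  using strategy_stealing shift unfolding bad_def by blast

lemma bad_own_move: "bad t M \<Longrightarrow> own (Suc t) \<Longrightarrow> zmove M N \<Longrightarrow> bad (Suc t) N"
  using position_zmove own_move zmove_not_zeckendorf unfolding bad_def by blast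

lemma bad_own_moves:
  assumes "\<And>Z. zmove (Z + U) (Z + V)" "\<forall>i<k. own (Suc (t + i))"
    and "bad t (Z + repeat_mset k U)"
  shows "bad (t + k) (Z + repeat_mset k V)"
  using assms(2,3)
proof (induction k arbitrary: Z)
  case (Suc k)
  \<comment> \<open>One copy of \<open>U\<close> waits in the remainder for the last move.\<close>
  have "bad (t + k) ((Z + U) + repeat_mset k V)"
    by (rule Suc.IH) (use Suc.prems in \<open>auto simp: ac_simps\<close>)
  then have "bad (t + k) ((Z + repeat_mset k V) + U)" by (simp add: ac_simps)
  then have "bad (Suc (t + k)) ((Z + repeat_mset k V) + V)"
    by (rule bad_own_move) (use Suc.prems assms(1) in auto)
  then show ?case by (simp add: ac_simps)
qed simp

text \<open>Two ones make a merge legal. If the alliance moves, the merge stays bad; otherwise some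
  opposing move does, or a win would be forced.\<close>

lemma bad_some_move:
  assumes "bad t M" "count M 1 \<ge> 2"
  shows "\<exists>N. zmove M N \<and> bad (Suc t) N"
proof -
  obtain Z where "M = Z + replicate_mset 2 1" using assms(2) by (rule mset_split_replicate)
  then have "zmove M (Z + {#2#})" using zmove_merge[of Z] by (simp add: numeral_2_eq_2)
  then show ?thesis
    using assms(1) bad_own_move position_zmove other_move zmove_not_zeckendorf
    unfolding bad_def by metis
qed

text \<open>Holds whoever moves. Each move costs at most two twos, and one move other than
  \<open>s\<close> at most one, so then the loss is at most \<open>2 * k - 1\<close>.\<close>

lemma bad_some_moves:
  assumes "bad t M" "count M 1 \<ge> 2 * k"
  shows "\<exists>N. bad (t + k) N \<and> count M 1 \<le> count N 1 + 2 * k \<and>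
    ((\<exists>Z. M = Z + repeat_mset k {#2, 2#} \<and> N = Z + repeat_mset k {#1, 3#}) \<or>
      count M 2 + 1 \<le> count N 2 + 2 * k)"
  using assms(2)
proof (induction k)
  case 0
  show ?case using assms(1) by (auto intro!: exI[of _ M])
next
  case (Suc k)
  then obtain N where N: "bad (t + k) N" "count M 1 \<le> count N 1 + 2 * k"
    "(\<exists>Z. M = Z + repeat_mset k {#2, 2#} \<and> N = Z + repeat_mset k {#1, 3#}) \<or>
      count M 2 + 1 \<le> count N 2 + 2 * k" by auto
  then obtain N' where N': "zmove N N'" "bad (Suc (t + k)) N'"
    using bad_some_move[of "t + k" N] Suc.prems by auto
  have ones: "count M 1 \<le> count N' 1 + 2 * Suc k" using N(2) zmove_count_one[OF N'(1)] by simp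
  have "(\<exists>Z. M = Z + repeat_mset (Suc k) {#2, 2#} \<and> N' = Z + repeat_mset (Suc k) {#1, 3#}) \<or>
      count M 2 + 1 \<le> count N' 2 + 2 * Suc k"
    using N(3)
  proof
    assume "\<exists>Z. M = Z + repeat_mset k {#2, 2#} \<and> N = Z + repeat_mset k {#1, 3#}"
    then obtain Z where Z: "M = Z + repeat_mset k {#2, 2#}" "N = Z + repeat_mset k {#1, 3#}"
      by blast
    from N'(1) show ?thesis
    proof (cases rule: zmove_cases_twos)
      case (split_twos K)
      then have K: "K + {#2, 2#} = Z + repeat_mset k {#1, 3#}" using Z by simp
      \<comment> \<open>No twos occur in \<open>{#1, 3#}\<close>, so both come from \<open>Z\<close>
        and were already in \<open>M\<close>.\<close>
      have "count Z 2 \<ge> 2" using arg_cong[OF K, of "\<lambda>A. count A 2"] by simp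
      then obtain Z' where "Z = Z' + replicate_mset 2 2" by (rule mset_split_replicate)
      then have Z': "Z = Z' + {#2, 2#}" by (simp add: numeral_2_eq_2)
      then have "K = Z' + repeat_mset k {#1, 3#}" using K by simp
      then show ?thesis using Z Z' split_twos by (intro disjI1 exI[of _ Z']) simp
    qed (simp add: Z)
  next
    assume "count M 2 + 1 \<le> count N 2 + 2 * k"
    then show ?thesis using zmove_count_two[OF N'(1)] by simp
  qed
  then show ?case using N'(2) ones by auto
qed

lemma bad_few_twos:
  assumes "bad t M" "\<forall>i<2 * d. own (Suc (t + i))" "count M 1 \<ge> 2 * d"
  shows "count M 2 < d"
proof (rule ccontr)
  assume "\<not> count M 2 < d"
  then obtain Y where Y: "M = Y + replicate_mset d 2" by (meson mset_split_replicate not_less)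
  then have "2 * d \<le> count Y 1" using assms(3) by simp
  then obtain Z where Z: "Y = Z + replicate_mset (2 * d) 1" by (rule mset_split_replicate)
  \<comment> \<open>Two groupings: for \<open>m\<^sup>d\<close>, keeping \<open>d\<close> twos for
    the later \<open>s\<^sup>d\<close>, and for \<open>c\<^sup>d\<close>, keeping \<open>d\<close>
    ones.\<close>
  have M: "M = (Z + repeat_mset d {#2#}) + repeat_mset d {#1, 1#}"
    "M = (Z + repeat_mset d {#1#}) + repeat_mset d {#1, 2#}"
    by (auto simp: Y Z intro!: multiset_eqI)
  have "bad (t + d) ((Z + repeat_mset d {#1#}) + repeat_mset d {#3#})"
    by (rule bad_own_moves[OF zmove_combine _ assms(1)[unfolded M(2)]]) (use assms(2) in auto)
  moreover have "bad (t + d) ((Z + repeat_mset d {#2#}) + repeat_mset d {#2#})"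
    by (rule bad_own_moves[OF zmove_merge _ assms(1)[unfolded M(1)]]) (use assms(2) in auto)
  then have "bad (t + d) (Z + repeat_mset d {#2, 2#})"
    by (rule back_subst[where P = "bad _"]) (auto intro!: multiset_eqI)
  then have "bad (t + d + d) (Z + repeat_mset d {#1, 3#})"
    by (rule bad_own_moves[OF zmove_split_twos, rotated]) (use assms(2) in \<open>auto simp: add.assoc\<close>)
  then have "bad (t + d + d) ((Z + repeat_mset d {#1#}) + repeat_mset d {#3#})"
    by (rule back_subst[where P = "bad _"]) (auto intro!: multiset_eqI)
  ultimately show False using bad_shift by blast
qed

text \<open>The \<open>2 * d\<close> merges spend \<open>4 * d\<close> ones and the next
  \<open>d\<close> moves at most \<open>2 * d\<close>, hence \<open>6 * d\<close>.\<close>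

lemma bad_round:
  assumes "bad t M" "\<forall>i<2 * d. own (Suc (t + i))" "count M 1 \<ge> 6 * d"
  shows "\<exists>N. bad (t + 3 * d) N \<and> count N 2 > count M 2 \<and> count M 1 \<le> count N 1 + 6 * d"
proof -
  have "4 * d \<le> count M 1" using assms(3) by simp
  then obtain Z where Z: "M = Z + replicate_mset (4 * d) 1" by (rule mset_split_replicate)
  have M: "M = Z + repeat_mset (2 * d) {#1, 1#}"
    "M = (Z + repeat_mset (2 * d) {#1#}) + repeat_mset d {#1, 1#}"
    by (auto simp: Z intro!: multiset_eqI)
  let ?Q = "Z + repeat_mset (2 * d) {#2#}"
  have "bad (t + 2 * d) ?Q"
    by (rule bad_own_moves[OF zmove_merge _ assms(1)[unfolded M(1)]]) (use assms(2) in auto)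
  moreover have "2 * d \<le> count ?Q 1" using assms(3) Z by simp
  ultimately obtain N where N: "bad (t + 2 * d + d) N" "count ?Q 1 \<le> count N 1 + 2 * d"
    "(\<exists>Y. ?Q = Y + repeat_mset d {#2, 2#} \<and> N = Y + repeat_mset d {#1, 3#}) \<or>
      count ?Q 2 + 1 \<le> count N 2 + 2 * d"
    using bad_some_moves by blast
  \<comment> \<open>The rival route \<open>m\<^sup>d c\<^sup>d\<close> ends at time
    \<open>t + 2 * d\<close>, so its end position is not bad at \<open>t + 3 * d\<close>; this rules
    out the reply \<open>s\<^sup>d\<close>.\<close>
  have "bad (t + d) ((Z + repeat_mset (2 * d) {#1#}) + repeat_mset d {#2#})"
    by (rule bad_own_moves[OF zmove_merge _ assms(1)[unfolded M(2)]]) (use assms(2) in auto)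
  then have "bad (t + d) ((Z + repeat_mset d {#1#}) + repeat_mset d {#1, 2#})"
    by (rule back_subst[where P = "bad _"]) (auto intro!: multiset_eqI)
  then have "bad (t + d + d) ((Z + repeat_mset d {#1#}) + repeat_mset d {#3#})"
    by (rule bad_own_moves[OF zmove_combine, rotated]) (use assms(2) in \<open>auto simp: add.assoc\<close>)
  then have "\<not> bad (t + 2 * d + d) ((Z + repeat_mset d {#1#}) + repeat_mset d {#3#})"
    using bad_shift[of "t + 2 * d"] by (simp add: mult_2 add.assoc)
  moreover have "(Z + repeat_mset d {#1#}) + repeat_mset d {#3#} = Z + repeat_mset d {#1, 3#}"
    by (auto intro!: multiset_eqI)
  ultimately have "N \<noteq> Z + repeat_mset d {#1, 3#}" using N(1) by metis
  moreover have "?Q = Z + repeat_mset d {#2, 2#}" by (auto intro!: multiset_eqI)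
  ultimately have "count ?Q 2 + 1 \<le> count N 2 + 2 * d" using N(3) by auto
  then have "count N 2 > count M 2" by (simp add: Z)
  moreover have "count M 1 \<le> count N 1 + 6 * d" using N(2) by (simp add: Z)
  ultimately show ?thesis using N(1) by (auto simp: algebra_simps)
qed

lemma bad_rounds:
  assumes "bad t M" "\<And>r i. i < 2 * d \<Longrightarrow> own (Suc (t + 3 * d * r + i))"
    and "count M 1 \<ge> 6 * d * r"
  shows "\<exists>N. bad (t + 3 * d * r) N \<and> count N 2 \<ge> r \<and> count M 1 \<le> count N 1 + 6 * d * r"
  using assms(3)
proof (induction r)
  case 0
  show ?case using assms(1) by auto
next
  case (Suc r)
  then obtain N where N: "bad (t + 3 * d * r) N" "count N 2 \<ge> r"
    "count M 1 \<le> count N 1 + 6 * d * r" by auto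
  moreover have "6 * d \<le> count N 1" using N(3) Suc.prems by simp
  ultimately obtain N' where "bad (t + 3 * d * r + 3 * d) N'" "count N' 2 > count N 2"
    "count N 1 \<le> count N' 1 + 6 * d"
    using bad_round[of "t + 3 * d * r" N] assms(2) by blast
  then show ?case using N by (intro exI[of _ N']) (auto simp: algebra_simps)
qed

text \<open>The moves before the first block cost at most \<open>6 * d\<close> ones, the
  \<open>d\<close> rounds \<open>6 * d\<^sup>2\<close>, and the last block needs
  \<open>2 * d\<close>.\<close>

lemma forces_start:
  assumes "n \<ge> 6 * d\<^sup>2 + 8 * d" "t \<le> 3 * d"
    and block: "\<And>r i. i < 2 * d \<Longrightarrow> own (Suc (t + 3 * d * r + i))"
  shows "forces n own 0 (replicate_mset n 1)"
proof (rule ccontr)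
  assume "\<not> forces n own 0 (replicate_mset n 1)"
  then have "bad 0 (replicate_mset n 1)" using position_start by (simp add: bad_def)
  then obtain M where M: "bad t M" "n \<le> count M 1 + 2 * t"
    using bad_some_moves[of 0 "replicate_mset n 1" t] assms(1,2) by fastforce
  then have ones: "count M 1 \<ge> 6 * d * d + 2 * d"
    using assms(1,2) by (simp add: power2_eq_square)
  then obtain N where N: "bad (t + 3 * d * d) N" "count N 2 \<ge> d"
    "count M 1 \<le> count N 1 + 6 * d * d"
    using bad_rounds[OF M(1) block, of d] by auto
  then show False using bad_few_twos[OF N(1)] block[of _ d] ones by simp
qed

end

section \<open>The order of the players\<close>

lemma next_player_funpow: "1 \<le> a \<Longrightarrow> a \<le> p \<Longrightarrow> (next_player p ^^ j) a = (a - 1 + j) mod p + 1"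
proof (induction j)
  case (Suc j)
  then show ?case by (simp add: next_player_def mod_Suc_eq)
qed auto

lemma mover_eq: "p \<ge> 1 \<Longrightarrow> mover p k = k mod p + 1"
  using next_player_funpow[of 1 p k] by (simp add: mover_def)

lemma consecutive_players_mover:
  assumes "consecutive_players p S" "p \<ge> 1"
  obtains b where "b \<le> p" "\<And>i. mover p i \<in> S \<longleftrightarrow> (i + b) mod p < card S"
proof -
  from assms(1) obtain a k where ak: "1 \<le> a" "a \<le> p" "k \<le> p"
    and S: "S = {(next_player p ^^ j) a |j. j < k}"
    unfolding consecutive_players_def by auto
  define f where "f j = (a - 1 + j) mod p + 1" for j
  \<comment> \<open>This is \<open>-(a - 1)\<close> modulo \<open>p\<close>: the first player of the
    arc gets residue 0.\<close>
  define b where "b = p - (a - 1)"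
  have S': "S = f ` {..<k}" using ak by (auto simp: S f_def next_player_funpow)
  have inverse: "(f j - 1 + b) mod p = j" if "j < k" for j
  proof -
    have "(f j - 1 + b) mod p = (a - 1 + j + b) mod p" by (simp add: f_def mod_simps)
    also have "a - 1 + j + b = j + p" using ak by (simp add: b_def)
    finally show ?thesis using that ak by simp
  qed
  then have "inj_on f {..<k}" by (intro inj_on_inverseI[where g = "\<lambda>x. (x - 1 + b) mod p"]) simp
  then have card: "card S = k" by (simp add: S' card_image)
  have "mover p i \<in> S \<longleftrightarrow> (i + b) mod p < k" for i
  proof
    assume "mover p i \<in> S"
    then obtain j where j: "j < k" "mover p i = f j" by (auto simp: S')
    have "(i + b) mod p = (mover p i - 1 + b) mod p"
      using mover_eq[OF assms(2)] by (simp add: mod_simps)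
    with j inverse[of j] show "(i + b) mod p < k" by simp
  next
    assume *: "(i + b) mod p < k"
    have "f ((i + b) mod p) = (a - 1 + (i + b)) mod p + 1" by (simp add: f_def mod_simps)
    also have "a - 1 + (i + b) = i + p" using ak by (simp add: b_def)
    finally have "f ((i + b) mod p) = mover p i"
      using mover_eq[OF assms(2)] by simp
    with * show "mover p i \<in> S" by (metis S' imageI lessThan_iff)
  qed
  then show thesis using that[of b] card by (simp add: b_def)
qed

theorem theorem1p3p7:
  fixes d n :: nat and S B :: "nat set"
  assumes "d \<ge> 1"
    and "n \<ge> 12 * d\<^sup>2 + 4 * d"
    and "consecutive_players (3 * d) S" and "card S = d"
    and "B = {1..3 * d} - S"
  shows "has_winning_strategy n (3 * d) B"
proof -
  have p: "3 * d \<ge> 1" using assms(1) by simp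
  then obtain b where b: "b \<le> 3 * d" "\<And>k. mover (3 * d) k \<in> S \<longleftrightarrow> (k + b) mod (3 * d) < d"
    using consecutive_players_mover[OF assms(3)] assms(4) by metis
  have mover_B: "mover (3 * d) k \<in> B \<longleftrightarrow> d \<le> (k + b) mod (3 * d)" for k
  proof -
    have "mover (3 * d) k \<in> {1..3 * d}" using p by (simp add: mover_eq Suc_le_eq)
    then show ?thesis using b(2)[of k] by (auto simp: assms(5))
  qed
  text \<open>The summand \<open>3 * d - 1\<close> is a shift by \<open>-1\<close> modulo the period.\<close>
  define own where "own k \<longleftrightarrow> mover (3 * d) (k + (3 * d - 1)) \<in> B" for k
  have own_Suc: "own (Suc k) \<longleftrightarrow> mover (3 * d) k \<in> B" for k
  proof -
    have "Suc k + (3 * d - 1) = k + 3 * d" using p by simp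
    then show ?thesis unfolding own_def using p by (simp add: mover_eq)
  qed
  \<comment> \<open>The small alliance holds the residues below \<open>d\<close>; adding
    \<open>d\<close> moves them to residues of the big one without wrapping.\<close>
  have shift: "own k \<or> own (k + d)" for k
  proof -
    define q where "q = (k + (3 * d - 1) + b) mod (3 * d)"
    have "(k + d + (3 * d - 1) + b) mod (3 * d) = (q + d) mod (3 * d)"
      by (simp add: q_def mod_simps ac_simps)
    moreover have "(q + d) mod (3 * d) = q + d" if "q < d" using that by simp
    ultimately show ?thesis unfolding own_def mover_B q_def[symmetric] by linarith
  qed
  \<comment> \<open>The start of a block of the big alliance: \<open>t + b\<close> is
    \<open>d\<close> or \<open>4 * d\<close>, both of residue \<open>d\<close>.\<close>
  define t where "t = (if b \<le> d then d - b else 4 * d - b)"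
  have t: "t \<le> 3 * d" "(t + b) mod (3 * d) = d"
    using b(1) assms(1) by (auto simp: t_def mod_if)
  have block: "own (Suc (t + 3 * d * r + i))" if "i < 2 * d" for r i
  proof -
    have "t + 3 * d * r + i + b = t + b + i + 3 * d * r" by simp
    then have "(t + 3 * d * r + i + b) mod (3 * d) = (t + b + i) mod (3 * d)"
      by (metis mod_mult_self2)
    also have "\<dots> = (d + i) mod (3 * d)" using t(2) by (metis mod_add_left_eq)
    also have "\<dots> = d + i" using that by simp
    finally show ?thesis by (simp add: own_Suc mover_B)
  qed
  have "d \<le> d\<^sup>2" using assms(1) by (simp add: power2_eq_square)
  then have n: "n \<ge> 6 * d\<^sup>2 + 8 * d" using assms(1,2) by linarith
  then have "forces n own 0 (replicate_mset n 1)" using forces_start[OF shift _ t(1) block] by blast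
  then show ?thesis using forces_imp_winning_strategy[OF own_Suc] n assms(1) by simp
qed

end
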